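(* Let $\mathcal{P}$ be a hereditary graph property and let $(G,\mathcal{D})$ be a vertex-weighted graph (with rational vertex weights) which is $\varepsilon$-far from $\mathcal{P}$. Then for every admissible $N$, any $(\mathcal{D},N)$-blowup of $G$ is $\varepsilon$-far from $\mathcal{P}$ (with respect to the uniform distribution on the vertices of the blowup).
   Context: All graphs are finite, simple and undirected. A graph property is a family of graphs closed under isomorphism; it is hereditary if it is closed under removal of vertices. A vertex-weighted graph is a pair $(G,\mathcal{D})$ with $G$ a graph and $\mathcal{D}$ a probability distribution on $V(G)$; all weights $\mathcal{D}(v)$ are assumed to be rational. For graphs $G_1,G_2$ on the same vertex set $V$ and a distribution $\mathcal{D}$ on $V$, their distance with respect to $\mathcal{D}$ is $\sum_{\{x,y\}\in E(G_1)\triangle E(G_2)}\mathcal{D}(x)\mathcal{D}(y)$; for the uniform distribution on $N$ vertices this is $|E(G_1)\triangle E(G_2)|/N^2$. $(G,\mathcal{D})$ is $\varepsilon$-far from $\mathcal{P}$ if for every $G'\in\mathcal{P}$ with $V(G')=V(G)$ the distance between $G$ and $G'$ with respect to $\mathcal{D}$ is at least $\varepsilon$. Let $V(G)=\{v_1,\dots,v_n\}$. For integers $b_1,\dots,b_n\ge 0$, a $(b_1,\dots,b_n)$-blowup of $G$ is any graph admitting a vertex partition $V_1\cup\dots\cup V_n$ such that $|V_i|=b_i$ for every $i$, and such that for $i\ne j$ the bipartite graph between $V_i$ and $V_j$ is complete if $\{v_i,v_j\}\in E(G)$ and empty if $\{v_i,v_j\}\notin E(G)$; the graphs induced by the sets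 $V_i$ may be arbitrary. A positive integer $N$ is admissible if $\mathcal{D}(v_i)\cdot N$ is an integer for every $1\le i\le n$. For admissible $N$, a $(\mathcal{D},N)$-blowup of $G$ is a $(b_1,\dots,b_n)$-blowup of $G$ with $b_i=\mathcal{D}(v_i)\cdot N$ for every $i$; it is treated as unweighted, i.e. with the uniform distribution on its $N$ vertices.
   Formalization: Every vertex of G is assumed to have positive weight; with zero weights the claim fails, e.g. for P = graphs with at most one vertex, G on two vertices with weights 1 and 0, and N = 1. *)

theory Defs
  imports "HOL-Probability.Probability_Mass_Function"
begin

text \<open>
  The type variable of the vertices plays the role of the universe from which all vertex
  sets are drawn. A graph property is a family of finite graphs over this universe.
\<close>

record 'a ugraph =
  verts :: "'a set"
  edges :: "'a set set"

definition simple_graph :: "'a ugraph \<Rightarrow> bool" where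
  "simple_graph G \<longleftrightarrow>
     finite (verts G) \<and> (\<forall>e\<in>edges G. e \<subseteq> verts G \<and> card e = 2)"

definition graph_iso :: "'a ugraph \<Rightarrow> 'b ugraph \<Rightarrow> bool" where
  "graph_iso G H \<longleftrightarrow>
     (\<exists>f. bij_betw f (verts G) (verts H) \<and>
          (\<forall>x\<in>verts G. \<forall>y\<in>verts G. {x, y} \<in> edges G \<longleftrightarrow> {f x, f y} \<in> edges H))"

definition remove_verts :: "'a ugraph \<Rightarrow> 'a set \<Rightarrow> 'a ugraph" where
  "remove_verts G W = \<lparr>verts = verts G - W, edges = {e \<in> edges G. e \<inter> W = {}}\<rparr>"

definition graph_property :: "'a ugraph set \<Rightarrow> bool" where
  "graph_property P \<longleftrightarrow>
     (\<forall>G\<in>P. simple_graph G) \<and>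
     (\<forall>G\<in>P. \<forall>H. simple_graph H \<and> graph_iso G H \<longrightarrow> H \<in> P)"

definition hereditary :: "'a ugraph set \<Rightarrow> bool" where
  "hereditary P \<longleftrightarrow> (\<forall>G\<in>P. \<forall>W. remove_verts G W \<in> P)"

definition vertex_weighted_graph :: "'a ugraph \<Rightarrow> 'a pmf \<Rightarrow> bool" where
  "vertex_weighted_graph G D \<longleftrightarrow>
     simple_graph G \<and> set_pmf D \<subseteq> verts G \<and> (\<forall>v\<in>verts G. pmf D v \<in> \<rat>)"

text \<open>
  Edges are two-element sets, so the factor indexed by \<open>e\<close> below is \<open>D(x) D(y)\<close> for
  \<open>e = {x, y}\<close>. Each unordered pair is counted once.
\<close>

definition graph_dist :: "'a pmf \<Rightarrow> 'a ugraph \<Rightarrow> 'a ugraph \<Rightarrow> real" where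
  "graph_dist D G1 G2 = (\<Sum>e\<in>sym_diff (edges G1) (edges G2). \<Prod>x\<in>e. pmf D x)"

definition far_from :: "real \<Rightarrow> 'a ugraph \<Rightarrow> 'a pmf \<Rightarrow> 'a ugraph set \<Rightarrow> bool" where
  "far_from \<epsilon> G D P \<longleftrightarrow>
     (\<forall>G'\<in>P. verts G' = verts G \<longrightarrow> graph_dist D G G' \<ge> \<epsilon>)"

text \<open>
  The parts of a blowup are indexed by the vertices of \<open>G\<close> and may be empty.
\<close>

definition is_blowup :: "('a \<Rightarrow> nat) \<Rightarrow> 'a ugraph \<Rightarrow> 'b ugraph \<Rightarrow> bool" where
  "is_blowup b G H \<longleftrightarrow>
     simple_graph H \<and>
     (\<exists>part. (\<Union>v\<in>verts G. part v) = verts H \<and>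
             disjoint_family_on part (verts G) \<and>
             (\<forall>v\<in>verts G. card (part v) = b v) \<and>
             (\<forall>v\<in>verts G. \<forall>w\<in>verts G. v \<noteq> w \<longrightarrow>
                (\<forall>x\<in>part v. \<forall>y\<in>part w. {x, y} \<in> edges H \<longleftrightarrow> {v, w} \<in> edges G)))"

definition admissible :: "'a ugraph \<Rightarrow> 'a pmf \<Rightarrow> nat \<Rightarrow> bool" where
  "admissible G D N \<longleftrightarrow> N > 0 \<and> (\<forall>v\<in>verts G. pmf D v * real N \<in> \<int>)"

definition is_weighted_blowup ::
  "'a ugraph \<Rightarrow> 'a pmf \<Rightarrow> nat \<Rightarrow> 'b ugraph \<Rightarrow> bool" where
  "is_weighted_blowup G D N H \<longleftrightarrow>
     (\<exists>b. (\<forall>v\<in>verts G. real (b v) = pmf D v * real N) \<and> is_blowup b G H)"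

end

theory Submission
  imports Defs
begin

text \<open>
  Let \<open>H'\<close> be a graph in \<open>P\<close> on the vertex set of the blowup \<open>H\<close>. Choosing one vertex from every
  part gives a section \<open>s\<close>, and \<open>H'\<close> induces a copy of some graph in \<open>P\<close> on the vertex set of \<open>G\<close>
  through \<open>s\<close>; this graph has distance at least \<open>\<epsilon>\<close> from \<open>G\<close>. A pair of vertices of \<open>H\<close> from two
  distinct parts \<open>v\<close>, \<open>w\<close> is hit by a uniformly random section with probability
  \<open>1 / (N\<^sup>2 D(v) D(w))\<close>, which cancels the weight \<open>D(v) D(w)\<close>. Hence averaging the distance over all
  sections yields at most the number of edges in which \<open>H\<close> and \<open>H'\<close> differ, divided by \<open>N\<^sup>2\<close>.
\<close>

text \<open>The condition \<open>card e = 2\<close> rules out loops, so the result is simple for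
  every map \<open>s\<close> and every finite \<open>V\<close>.\<close>

definition pullback_graph :: "('a \<Rightarrow> 'b) \<Rightarrow> 'a set \<Rightarrow> 'b ugraph \<Rightarrow> 'a ugraph" where
  "pullback_graph s V H = \<lparr>verts = V, edges = {e. e \<subseteq> V \<and> card e = 2 \<and> s ` e \<in> edges H}\<rparr>"

lemma verts_pullback_graph [simp]: "verts (pullback_graph s V H) = V"
  by (simp add: pullback_graph_def)

lemma pullback_graph_in_property:
  fixes P :: "'a ugraph set" and s :: "'a \<Rightarrow> 'a"
  assumes P: "graph_property P" "hereditary P" and "H \<in> P"
    and "finite V" and inj: "inj_on s V" and sub: "s ` V \<subseteq> verts H"
  shows "pullback_graph s V H \<in> P"
proof -
  let ?R = "remove_verts H (verts H - s ` V)"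
  have "?R \<in> P"
    using P(2) \<open>H \<in> P\<close> by (simp add: hereditary_def)
  have card_edge: "card e = 2" if "e \<in> edges H" for e
    using that P(1) \<open>H \<in> P\<close> unfolding graph_property_def simple_graph_def by blast
  have "graph_iso ?R (pullback_graph s V H)"
    unfolding graph_iso_def
  proof (intro exI conjI ballI)
    have verts_R: "verts ?R = s ` V"
      using sub by (auto simp: remove_verts_def)
    show "bij_betw (the_inv_into V s) (verts ?R) (verts (pullback_graph s V H))"
      using bij_betw_the_inv_into[OF inj_on_imp_bij_betw[OF inj]] by (simp add: verts_R)
    fix x y assume "x \<in> verts ?R" "y \<in> verts ?R"
    then obtain v w where vw: "v \<in> V" "w \<in> V" and x: "x = s v" and y: "y = s w"
      unfolding verts_R by auto
    \<comment> \<open>The definition of \<open>graph_iso\<close> also ranges over x = y; the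
      singleton arising there is an edge on neither side.\<close>
    have "v \<noteq> w" if "{x, y} \<in> edges H"
      using card_edge[OF that] x y by auto
    then show "{x, y} \<in> edges ?R \<longleftrightarrow>
        {the_inv_into V s x, the_inv_into V s y} \<in> edges (pullback_graph s V H)"
      using vw by (auto simp: x y the_inv_into_f_f[OF inj] remove_verts_def pullback_graph_def)
  qed
  moreover have "simple_graph (pullback_graph s V H)"
    using \<open>finite V\<close> by (auto simp: simple_graph_def pullback_graph_def)
  ultimately show ?thesis
    using P(1) \<open>?R \<in> P\<close> unfolding graph_property_def by blast
qed

text \<open>By disjointness a section meeting x takes the value x at v, and likewise y at w, so only
  the other coordinates remain free. If v = w no section contains both vertices. The bound is
  multiplied out to stay within the natural numbers.\<close>

lemma card_sections_through_pair:
  fixes A :: "'i \<Rightarrow> 'b set" and x y :: 'b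
  assumes "finite V" and fin: "\<And>u. u \<in> V \<Longrightarrow> finite (A u)" and disj: "disjoint_family_on A V"
    and xv: "v \<in> V" "x \<in> A v" and yw: "w \<in> V" "y \<in> A w" and "x \<noteq> y"
  shows "card {s \<in> PiE V A. x \<in> s ` V \<and> y \<in> s ` V} * (card (A v) * card (A w))
           \<le> (\<Prod>u\<in>V. card (A u))"
proof -
  let ?T = "{s \<in> PiE V A. x \<in> s ` V \<and> y \<in> s ` V}"
  have through: "s u = z" if "s \<in> PiE V A" "z \<in> s ` V" "z \<in> A u" "u \<in> V" for s z u
    using that disj by (fastforce simp: disjoint_family_on_def)
  have T: "s v = x \<and> s w = y" if "s \<in> ?T" for s
    using that through xv yw by blast
  show ?thesis
  proof (cases "v = w")
    case True
    have "?T = {}"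
    proof (intro equals0I)
      fix s assume "s \<in> ?T"
      then show False
        using T[of s] True \<open>x \<noteq> y\<close> by metis
    qed
    then show ?thesis
      by (simp only: card.empty)
  next
    case False
    define B where "B u = (if u = v then {x} else if u = w then {y} else A u)" for u
    have rest: "(\<Prod>u\<in>V. f u) = f v * (f w * (\<Prod>u\<in>V - {v} - {w}. f u))" for f :: "'i \<Rightarrow> nat"
      using xv yw False \<open>finite V\<close> by (simp add: prod.remove[of V v] prod.remove[of "V - {v}" w])
    have *: "(\<Prod>u\<in>V - {v} - {w}. card (B u)) = (\<Prod>u\<in>V - {v} - {w}. card (A u))"
      by (rule prod.cong) (auto simp: B_def)
    have "?T \<subseteq> PiE V B"
    proof
      fix s assume s: "s \<in> ?T"
      then show "s \<in> PiE V B"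
        using T[OF s] False by (auto simp: B_def PiE_iff)
    qed
    moreover have "finite (PiE V B)"
      using fin \<open>finite V\<close> by (intro finite_PiE) (auto simp: B_def)
    ultimately have "card ?T \<le> (\<Prod>u\<in>V. card (B u))"
      using card_mono[of "PiE V B" ?T] card_PiE[OF \<open>finite V\<close>, of B] by linarith
    also have "\<dots> = (\<Prod>u\<in>V - {v} - {w}. card (A u))"
      using False by (subst rest) (simp add: * B_def[of v] B_def[of w])
    finally have "card ?T * (card (A v) * card (A w))
        \<le> (\<Prod>u\<in>V - {v} - {w}. card (A u)) * (card (A v) * card (A w))"
      by (rule mult_right_mono) simp
    also have "\<dots> = (\<Prod>u\<in>V. card (A u))"
      by (subst rest[of "\<lambda>u. card (A u)"]) (simp add: mult_ac)
    finally show ?thesis .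
  qed
qed

text \<open>On the chosen representatives \<open>H\<close> copies the adjacency of \<open>G\<close>,
  while the pullback copies that of \<open>H'\<close>; hence \<open>s\<close> carries each
  disagreement to a disagreement.\<close>

lemma sym_diff_pullback_graph:
  assumes "simple_graph G" "V = verts G" and inj: "inj_on s V"
    and blow: "\<And>v w. v \<in> V \<Longrightarrow> w \<in> V \<Longrightarrow> v \<noteq> w \<Longrightarrow> {s v, s w} \<in> edges H \<longleftrightarrow> {v, w} \<in> edges G"
    and e: "e \<in> sym_diff (edges G) (edges (pullback_graph s V H'))"
  shows "e \<subseteq> V" "s ` e \<in> sym_diff (edges H) (edges H')"
proof -
  have V: "e \<subseteq> V" and 2: "card e = 2"
    using assms by (auto simp: simple_graph_def pullback_graph_def)
  from 2 obtain v w where vw: "e = {v, w}" "v \<noteq> w"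
    by (auto simp: card_2_iff)
  then have "s ` e \<in> edges H \<longleftrightarrow> e \<in> edges G"
    using blow V by simp
  moreover have "s ` e \<in> edges H' \<longleftrightarrow> e \<in> edges (pullback_graph s V H')"
    using V 2 by (simp add: pullback_graph_def)
  ultimately show "e \<subseteq> V" "s ` e \<in> sym_diff (edges H) (edges H')"
    using V e by auto
qed

lemma graph_dist_uniform:
  assumes "simple_graph H" "simple_graph H'" "verts H' = verts H"
  shows "graph_dist (pmf_of_set (verts H)) H H'
           = card (sym_diff (edges H) (edges H')) / (card (verts H))\<^sup>2"
proof -
  have "(\<Prod>x\<in>e. pmf (pmf_of_set (verts H)) x) = 1 / (card (verts H))\<^sup>2"
    if e: "e \<in> sym_diff (edges H) (edges H')" for e
  proof -
    have sub: "e \<subseteq> verts H" and 2: "card e = 2"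
      using e assms by (auto simp: simple_graph_def)
    then have "finite (verts H)" "verts H \<noteq> {}"
      using assms(1) by (auto simp: simple_graph_def)
    then have "(\<Prod>x\<in>e. pmf (pmf_of_set (verts H)) x) = (\<Prod>x\<in>e. 1 / card (verts H))"
      using sub by (intro prod.cong) (auto simp: indicator_def)
    then show ?thesis
      by (simp add: 2 power_divide)
  qed
  then show ?thesis
    by (simp add: graph_dist_def)
qed

theorem lemma5p5:
  fixes P :: "'a ugraph set" and G H :: "'a ugraph" and D :: "'a pmf"
    and \<epsilon> :: real and N :: nat
  assumes "graph_property P" and "hereditary P"
    and "vertex_weighted_graph G D"
    and "\<forall>v\<in>verts G. pmf D v > 0"
    and "far_from \<epsilon> G D P"
    and "admissible G D N"
    and "is_weighted_blowup G D N H"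
  shows "far_from \<epsilon> H (pmf_of_set (verts H)) P"
  unfolding far_from_def
proof (intro ballI impI)
  fix H' assume "H' \<in> P" and verts_H': "verts H' = verts H"
  define V where "V = verts G"
  have G: "simple_graph G" "finite V" "set_pmf D \<subseteq> V"
    using assms(3) by (auto simp: vertex_weighted_graph_def simple_graph_def V_def)
  have "N > 0"
    using assms(6) by (simp add: admissible_def)
  obtain b where b': "\<forall>v\<in>V. real (b v) = pmf D v * real N" and "is_blowup b G H"
    using assms(7) by (auto simp: is_weighted_blowup_def V_def)
  then obtain A where b: "\<And>v. v \<in> V \<Longrightarrow> real (b v) = pmf D v * real N"
    and H: "simple_graph H" and A: "(\<Union>v\<in>V. A v) = verts H" "disjoint_family_on A V"
    and card_A: "\<And>v. v \<in> V \<Longrightarrow> card (A v) = b v"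
    and blow: "\<And>v w x y. v \<in> V \<Longrightarrow> w \<in> V \<Longrightarrow> v \<noteq> w \<Longrightarrow> x \<in> A v \<Longrightarrow> y \<in> A w \<Longrightarrow>
                 {x, y} \<in> edges H \<longleftrightarrow> {v, w} \<in> edges G"
    unfolding is_blowup_def V_def[symmetric] by auto
  have H': "simple_graph H'"
    using assms(1) \<open>H' \<in> P\<close> unfolding graph_property_def by blast
  have "finite (verts H)"
    using H by (simp add: simple_graph_def)
  then have fin_A: "finite (A v)" if "v \<in> V" for v
    using A(1) that by (metis UN_upper finite_subset)
  \<comment> \<open>Positive weights make all parts nonempty, so sections exist and their number
    \<open>M\<close> can be cancelled at the end.\<close>
  have b_pos: "b v > 0" if "v \<in> V" for v
    using that b[OF that] assms(4) \<open>N > 0\<close> by (metis V_def mult_pos_pos of_nat_0_less_iff)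
  have "card (verts H) = (\<Sum>v\<in>V. b v)"
    using card_UN_disjoint'[OF A(2) _ G(2)] fin_A card_A by (simp add: A(1))
  then have "real (card (verts H)) = (\<Sum>v\<in>V. pmf D v) * N"
    by (simp add: b sum_distrib_right)
  then have card_H: "card (verts H) = N"
    using sum_pmf_eq_1[OF G(2,3)] by simp

  \<comment> \<open>The index of the part containing x, well defined on \<open>verts H\<close>; this
    map is a left inverse of every section.\<close>
  define p where "p x = (THE v. v \<in> V \<and> x \<in> A v)" for x
  have p: "p x = v" if "v \<in> V" "x \<in> A v" for x v
    unfolding p_def using that A(2) by (intro the_equality) (auto simp: disjoint_family_on_def)
  define S where "S = PiE V A"
  define M where "M = (\<Prod>v\<in>V. card (A v))"
  define F where "F = sym_diff (edges H) (edges H')"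
  have card_S: "card S = M"
    using G(2) by (simp add: S_def M_def card_PiE)
  have "M > 0"
    using b_pos by (auto simp: M_def card_A intro!: prod_pos)
  then have "finite S"
    using card_S by (intro card_ge_0_finite) simp
  have F: "f \<subseteq> verts H" "card f = 2" if "f \<in> F" for f
    using that H H' verts_H' by (auto simp: F_def simple_graph_def)
  then have "finite F"
    using \<open>finite (verts H)\<close> by (meson Pow_iff finite_Pow_iff finite_subset subsetI)

  have "\<epsilon> \<le> (\<Sum>f\<in>{f \<in> F. f \<subseteq> s ` V}. \<Prod>x\<in>f. pmf D (p x))" if "s \<in> S" for s
  proof -
    have sA: "s v \<in> A v" if "v \<in> V" for v
      using \<open>s \<in> S\<close> that by (auto simp: S_def)
    then have ps: "p (s v) = v" if "v \<in> V" for v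
      using p that by blast
    then have inj: "inj_on s V"
      by (metis inj_onI)
    define G' where "G' = pullback_graph s V H'"
    have "G' \<in> P"
      unfolding G'_def using assms(1,2) \<open>H' \<in> P\<close> G(2) inj
    proof (rule pullback_graph_in_property)
      show "s ` V \<subseteq> verts H'"
        using sA A(1) verts_H' by blast
    qed
    then have "\<epsilon> \<le> graph_dist D G G'"
      using assms(5) by (simp add: far_from_def G'_def V_def)
    also have "\<dots> \<le> (\<Sum>f\<in>{f \<in> F. f \<subseteq> s ` V}. \<Prod>x\<in>f. pmf D (p x))"
      unfolding graph_dist_def
    proof (rule sum_le_included[where i = "\<lambda>f. p ` f"])
      note sd = sym_diff_pullback_graph[OF G(1) V_def inj, of H _ H', folded G'_def F_def]
      have sub: "e \<subseteq> V" and F: "s ` e \<in> F" if "e \<in> sym_diff (edges G) (edges G')" for e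
        using sd[OF _ that] blow sA by blast+
      show "finite (sym_diff (edges G) (edges G'))"
        using sub G(2) by (meson Pow_iff finite_Pow_iff finite_subset subsetI)
      show "\<forall>e\<in>sym_diff (edges G) (edges G'). \<exists>f\<in>{f \<in> F. f \<subseteq> s ` V}. p ` f = e \<and>
              (\<Prod>x\<in>e. pmf D x) \<le> (\<Prod>x\<in>f. pmf D (p x))"
      proof
        fix e assume e: "e \<in> sym_diff (edges G) (edges G')"
        have "p ` s ` e = e"
          using sub[OF e] ps by force
        moreover have "(\<Prod>x\<in>s ` e. pmf D (p x)) = (\<Prod>v\<in>e. pmf D v)"
          using inj_on_subset[OF inj sub[OF e]] ps sub[OF e] by (auto simp: prod.reindex intro!: prod.cong)
        ultimately show "\<exists>f\<in>{f \<in> F. f \<subseteq> s ` V}. p ` f = e \<and>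
              (\<Prod>x\<in>e. pmf D x) \<le> (\<Prod>x\<in>f. pmf D (p x))"
          using F[OF e] sub[OF e] by (intro bexI[of _ "s ` e"]) auto
      qed
    qed (use \<open>finite F\<close> in \<open>auto intro!: prod_nonneg\<close>)
    finally show ?thesis .
  qed
  then have "real M * \<epsilon> \<le> (\<Sum>s\<in>S. \<Sum>f\<in>{f \<in> F. f \<subseteq> s ` V}. \<Prod>x\<in>f. pmf D (p x))"
    using sum_mono[of S "\<lambda>_. \<epsilon>"] card_S by simp
  \<comment> \<open>Double counting: from here on the pair is fixed and the sections containing it
    are counted.\<close>
  also have "\<dots> = (\<Sum>f\<in>F. \<Sum>s\<in>{s \<in> S. f \<subseteq> s ` V}. \<Prod>x\<in>f. pmf D (p x))"
    using \<open>finite S\<close> \<open>finite F\<close> by (rule sum.swap_restrict)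
  also have "\<dots> \<le> (\<Sum>f\<in>F. M / N\<^sup>2)"
  proof (rule sum_mono)
    fix f assume "f \<in> F"
    then obtain x y where f: "f = {x, y}" "x \<noteq> y"
      using F(2) by (metis card_2_iff)
    then obtain v w where v: "v \<in> V" "x \<in> A v" and w: "w \<in> V" "y \<in> A w"
      using F(1)[OF \<open>f \<in> F\<close>] by (auto simp: A(1)[symmetric])
    \<comment> \<open>Here v = w is possible, since \<open>H\<close> is arbitrary inside a part;
      such a pair lies in no section and contributes 0.\<close>
    have "card {s \<in> S. f \<subseteq> s ` V} * (b v * b w) \<le> M"
      using card_sections_through_pair[OF G(2) fin_A A(2) v w f(2)] v w
      by (simp add: S_def M_def f(1) card_A)
    then have "card {s \<in> S. f \<subseteq> s ` V} * (real (b v) * real (b w)) \<le> M"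
      by (metis of_nat_le_iff of_nat_mult)
    moreover have "(\<Prod>x\<in>f. pmf D (p x)) = real (b v) * real (b w) / N\<^sup>2"
      using f v w p b \<open>N > 0\<close> by (simp add: power2_eq_square)
    ultimately show "(\<Sum>s\<in>{s \<in> S. f \<subseteq> s ` V}. \<Prod>x\<in>f. pmf D (p x)) \<le> M / N\<^sup>2"
      by (simp add: divide_right_mono)
  qed
  also have "\<dots> = M * graph_dist (pmf_of_set (verts H)) H H'"
    by (simp add: graph_dist_uniform[OF H H' verts_H'] card_H F_def)
  finally show "\<epsilon> \<le> graph_dist (pmf_of_set (verts H)) H H'"
    using \<open>M > 0\<close> by simp
qed

end
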